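(* Let $\mathbf{L}$ be a complete residuated lattice on the real unit interval satisfying $a\rightarrow\bigvee_{i\in I}b_i=\bigvee_{i\in I}(a\rightarrow b_i)$ for all $a\in[0,1]$ and all families $\{b_i\}\subseteq[0,1]$, and let $C:L^{\mathrm{Var}}\to L^{\mathrm{Var}}$ be a finitary $\mathbf{L}$-closure operator. Then there is a theory $\Sigma$ such that $C=C_\Sigma$, where $C_\Sigma(e)=e^\omega_\Sigma$ for all $e\in L^{\mathrm{Var}}$.
   Context: A complete residuated lattice on $[0,1]$: $\wedge,\vee$ are min, max, $\langle[0,1],\otimes,1\rangle$ is a commutative monoid and $a\otimes b\le c$ iff $a\le b\rightarrow c$. An $\mathbf{L}$-set in $U$ is a map $U\to[0,1]$; $L^U$ is the set of all of them; finite = finite support; rational = rational values; $A\subseteq B$ pointwise $\le$; unions pointwise suprema; $(c\otimes A)(u)=c\otimes A(u)$; $S(A,B)=\bigwedge_u(A(u)\rightarrow B(u))$. $\mathrm{Var}$ is a denumerable set of propositional variables; a formula is $A\Rightarrow B$ with $A,B$ finite rational $\mathbf{L}$-sets in $\mathrm{Var}$; a theory is a (possibly infinite) set of formulas. For $e\in L^{\mathrm{Var}}$: $e^0_\Sigma=e$, $e^{n+1}_\Sigma=e^n_\Sigma\cup\bigcup\{S(A,e^n_\Sigma)\otimes B: A\Rightarrow B\in\Sigma\}$, $e^\omega_\Sigma=\bigcup_{n<\omega}e^n_\Sigma$. An $\mathbf{L}$-closure operator on $U$ is $C:L^U\to L^U$ with $A\subseteq C(A)$, $S(A,B)\le S(C(A),C(B))$,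 $C(C(A))=C(A)$ for all $A,B$; it is finitary if $C(A)=\bigcup\{C(B):B\subseteq A,\ B\text{ finite}\}$ for all $A$. *)

theory Defs
  imports Complex_Main "HOL-Library.Countable" "HOL-Library.Infinite_Typeclass"
begin

typedef unit_interval = "{0..1::real}"
  morphisms real_of_unit unit_of_real
  by (rule exI[of _ 0]) simp

instantiation unit_interval :: complete_linorder
begin

definition less_eq_unit_interval :: "unit_interval \<Rightarrow> unit_interval \<Rightarrow> bool" where
  "a \<le> b \<longleftrightarrow> real_of_unit a \<le> real_of_unit b"

definition less_unit_interval :: "unit_interval \<Rightarrow> unit_interval \<Rightarrow> bool" where
  "a < b \<longleftrightarrow> real_of_unit a < real_of_unit b"

definition inf_unit_interval :: "unit_interval \<Rightarrow> unit_interval \<Rightarrow> unit_interval" where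
  "inf_unit_interval a b = (if a \<le> b then a else b)"

definition sup_unit_interval :: "unit_interval \<Rightarrow> unit_interval \<Rightarrow> unit_interval" where
  "sup_unit_interval a b = (if a \<le> b then b else a)"

definition bot_unit_interval :: unit_interval where
  "bot = unit_of_real 0"

definition top_unit_interval :: unit_interval where
  "top = unit_of_real 1"

(* Inserting 0 (resp. 1) makes the supremum (resp. infimum) of the empty set the least
   (resp. greatest) element; on the reals these are unspecified. *)
definition Sup_unit_interval :: "unit_interval set \<Rightarrow> unit_interval" where
  "Sup X = unit_of_real (Sup (insert 0 (real_of_unit ` X)))"

definition Inf_unit_interval :: "unit_interval set \<Rightarrow> unit_interval" where
  "Inf X = unit_of_real (Inf (insert 1 (real_of_unit ` X)))"

instance
proof
  have rng: "0 \<le> real_of_unit a" "real_of_unit a \<le> 1" for a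
    using real_of_unit[of a] by auto
  have ba: "bdd_above (insert 0 (real_of_unit ` X))" for X
    using rng by (intro bdd_aboveI[of _ 1]) auto
  have bb: "bdd_below (insert 1 (real_of_unit ` X))" for X
    using rng by (intro bdd_belowI[of _ 0]) auto
  have S: "real_of_unit (Sup X) = Sup (insert 0 (real_of_unit ` X))" for X
  proof -
    have "0 \<le> Sup (insert 0 (real_of_unit ` X))"
      by (rule cSup_upper[OF _ ba]) simp
    moreover have "Sup (insert 0 (real_of_unit ` X)) \<le> 1"
      using rng by (intro cSup_least) auto
    ultimately show ?thesis
      unfolding Sup_unit_interval_def by (intro unit_of_real_inverse) simp
  qed
  have I: "real_of_unit (Inf X) = Inf (insert 1 (real_of_unit ` X))" for X
  proof -
    have "Inf (insert 1 (real_of_unit ` X)) \<le> 1"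
      by (rule cInf_lower[OF _ bb]) simp
    moreover have "0 \<le> Inf (insert 1 (real_of_unit ` X))"
      using rng by (intro cInf_greatest) auto
    ultimately show ?thesis
      unfolding Inf_unit_interval_def by (intro unit_of_real_inverse) simp
  qed
  fix x y z :: unit_interval and X :: "unit_interval set"
  show "x < y \<longleftrightarrow> x \<le> y \<and> \<not> y \<le> x"
    by (auto simp: less_eq_unit_interval_def less_unit_interval_def)
  show "x \<le> x" "x \<le> y \<Longrightarrow> y \<le> z \<Longrightarrow> x \<le> z" "x \<le> y \<or> y \<le> x"
    by (auto simp: less_eq_unit_interval_def)
  show "x \<le> y \<Longrightarrow> y \<le> x \<Longrightarrow> x = y"
    by (simp add: less_eq_unit_interval_def flip: real_of_unit_inject)
  show "inf x y \<le> x" "inf x y \<le> y" "x \<le> y \<Longrightarrow> x \<le> z \<Longrightarrow> x \<le> inf y z"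
    "x \<le> sup x y" "y \<le> sup x y" "y \<le> x \<Longrightarrow> z \<le> x \<Longrightarrow> sup y z \<le> x"
    by (auto simp: inf_unit_interval_def sup_unit_interval_def less_eq_unit_interval_def)
  show "Inf X \<le> x" if "x \<in> X"
    unfolding less_eq_unit_interval_def I using that by (intro cInf_lower[OF _ bb]) simp
  show "z \<le> Inf X" if "\<And>x. x \<in> X \<Longrightarrow> z \<le> x"
    unfolding less_eq_unit_interval_def I
    using that rng by (intro cInf_greatest) (auto simp: less_eq_unit_interval_def)
  show "x \<le> Sup X" if "x \<in> X"
    unfolding less_eq_unit_interval_def S using that by (intro cSup_upper[OF _ ba]) simp
  show "Sup X \<le> z" if "\<And>x. x \<in> X \<Longrightarrow> x \<le> z"
    unfolding less_eq_unit_interval_def S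
    using that rng by (intro cSup_least) (auto simp: less_eq_unit_interval_def)
  show "Inf {} = (top :: unit_interval)" "Sup {} = (bot :: unit_interval)"
    by (simp_all add: Inf_unit_interval_def Sup_unit_interval_def
        top_unit_interval_def bot_unit_interval_def)
qed

end

(* The lattice part (min, max, 0 = bot, 1 = top, completeness) is the class instance above. *)
locale residuated_lattice_01 =
  fixes tensor :: "unit_interval \<Rightarrow> unit_interval \<Rightarrow> unit_interval"
    and imp :: "unit_interval \<Rightarrow> unit_interval \<Rightarrow> unit_interval"
  assumes tensor_comm_monoid: "comm_monoid tensor top"
    and adjointness: "tensor a b \<le> c \<longleftrightarrow> a \<le> imp b c"

(* Inclusion and unions of L-sets are the pointwise order and suprema on functions. *)
type_synonym 'u lset = "'u \<Rightarrow> unit_interval"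

definition finite_lset :: "'u lset \<Rightarrow> bool" where
  "finite_lset A \<longleftrightarrow> finite {u. A u \<noteq> bot}"

definition rational_lset :: "'u lset \<Rightarrow> bool" where
  "rational_lset A \<longleftrightarrow> (\<forall>u. real_of_unit (A u) \<in> \<rat>)"

definition scale_lset ::
  "(unit_interval \<Rightarrow> unit_interval \<Rightarrow> unit_interval) \<Rightarrow> unit_interval \<Rightarrow> 'u lset \<Rightarrow> 'u lset" where
  "scale_lset tensor c A = (\<lambda>u. tensor c (A u))"

definition subsethood ::
  "(unit_interval \<Rightarrow> unit_interval \<Rightarrow> unit_interval) \<Rightarrow> 'u lset \<Rightarrow> 'u lset \<Rightarrow> unit_interval" where
  "subsethood imp A B = (INF u. imp (A u) (B u))"

(* The pair (A, B) encodes the formula written A => B. *)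
type_synonym 'v fml = "'v lset \<times> 'v lset"

definition is_formula :: "'v fml \<Rightarrow> bool" where
  "is_formula \<phi> \<longleftrightarrow> (case \<phi> of (A, B) \<Rightarrow>
     finite_lset A \<and> rational_lset A \<and> finite_lset B \<and> rational_lset B)"

definition is_theory :: "'v fml set \<Rightarrow> bool" where
  "is_theory \<Sigma> \<longleftrightarrow> (\<forall>\<phi>\<in>\<Sigma>. is_formula \<phi>)"

primrec iter ::
  "(unit_interval \<Rightarrow> unit_interval \<Rightarrow> unit_interval) \<Rightarrow>
   (unit_interval \<Rightarrow> unit_interval \<Rightarrow> unit_interval) \<Rightarrow>
   'v fml set \<Rightarrow> 'v lset \<Rightarrow> nat \<Rightarrow> 'v lset" where
  "iter tensor imp \<Sigma> e 0 = e"
| "iter tensor imp \<Sigma> e (Suc n) =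
     sup (iter tensor imp \<Sigma> e n)
         (SUP (A, B)\<in>\<Sigma>. scale_lset tensor (subsethood imp A (iter tensor imp \<Sigma> e n)) B)"

definition theory_closure ::
  "(unit_interval \<Rightarrow> unit_interval \<Rightarrow> unit_interval) \<Rightarrow>
   (unit_interval \<Rightarrow> unit_interval \<Rightarrow> unit_interval) \<Rightarrow>
   'v fml set \<Rightarrow> 'v lset \<Rightarrow> 'v lset" where
  "theory_closure tensor imp \<Sigma> e = (SUP n. iter tensor imp \<Sigma> e n)"

definition L_closure_operator ::
  "(unit_interval \<Rightarrow> unit_interval \<Rightarrow> unit_interval) \<Rightarrow> ('u lset \<Rightarrow> 'u lset) \<Rightarrow> bool" where
  "L_closure_operator imp C \<longleftrightarrow>
     (\<forall>A. A \<le> C A) \<and>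
     (\<forall>A B. subsethood imp A B \<le> subsethood imp (C A) (C B)) \<and>
     (\<forall>A. C (C A) = C A)"

definition finitary :: "('u lset \<Rightarrow> 'u lset) \<Rightarrow> bool" where
  "finitary C \<longleftrightarrow> (\<forall>A. C A = Sup {C B | B. B \<le> A \<and> finite_lset B})"

end

theory Submission
  imports Defs
begin

text \<open>
  Take for \<open>\<Sigma>\<close> all formulas \<open>A \<Rightarrow> B\<close> with \<open>B \<subseteq> C(A)\<close>. Since \<open>S(A, C(e)) \<le> S(C(A), C(C(e))) \<le> S(B, C(e))\<close>,
  \<open>C(e)\<close> is a model of \<open>\<Sigma>\<close>, so it contains \<open>C\<^sub>\<Sigma>(e)\<close>. Conversely, \<open>C(e)\<close> is the union of the \<open>C(D)\<close>
  for finite \<open>D \<subseteq> e\<close>. As residuation commutes with suprema in its second argument, such a \<open>D\<close> has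
  finite rational subsets \<open>A\<close> with \<open>S(D, A)\<close> arbitrarily close to \<open>1\<close>; from \<open>S(D, A) \<le> S(C(D), C(A))\<close>
  it follows that \<open>C(D)\<close> is the union of the \<open>C(A)\<close>. Finally \<open>C(A)\<close> is the union of its finite rational
  subsets, each of which is the consequent of a formula of \<open>\<Sigma>\<close> with antecedent \<open>A\<close>.
\<close>

lemma real_of_unit_bot [simp]: "real_of_unit bot = 0"
  by (simp add: bot_unit_interval_def unit_of_real_inverse)

lemma rational_dense_unit_interval:
  fixes a b :: unit_interval
  assumes "a < b"
  obtains q where "a < q" "q < b" "real_of_unit q \<in> \<rat>"
proof -
  from assms obtain r where r: "r \<in> \<rat>" "real_of_unit a < r" "r < real_of_unit b"
    using Rats_dense_in_real unfolding less_unit_interval_def by blast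
  then have "real_of_unit (unit_of_real r) = r"
    using real_of_unit[of a] real_of_unit[of b] by (intro unit_of_real_inverse) auto
  with r that[of "unit_of_real r"] show thesis
    by (simp add: less_unit_interval_def)
qed

instance unit_interval :: dense_linorder
  by standard (blast elim: rational_dense_unit_interval)

lemma Sup_rationals_le: "Sup {q. real_of_unit q \<in> \<rat> \<and> q \<le> b} = (b :: unit_interval)"
    (is "Sup ?Q = b")
proof (rule antisym)
  show "b \<le> Sup ?Q"
  proof (rule ccontr)
    assume "\<not> b \<le> Sup ?Q"
    then obtain q where "Sup ?Q < q" "q < b" "real_of_unit q \<in> \<rat>"
      using rational_dense_unit_interval[of "Sup ?Q" b] by (auto simp: not_le)
    moreover from this have "q \<le> Sup ?Q"
      by (intro Sup_upper) simp
    ultimately show False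
      by simp
  qed
qed (auto intro: Sup_least)

lemma finite_lset_subset: "A \<le> D \<Longrightarrow> finite_lset D \<Longrightarrow> finite_lset A"
  unfolding finite_lset_def
  by (erule rev_finite_subset) (metis (mono_tags, lifting) Collect_mono bot_unique le_funD)

definition finite_rational_subsets :: "'u lset \<Rightarrow> 'u lset set" where
  "finite_rational_subsets D = {A. A \<le> D \<and> finite_lset A \<and> rational_lset A}"

lemma singleton_mem_finite_rational_subsets:
  assumes "real_of_unit q \<in> \<rat>" "q \<le> A u"
  shows "bot(u := q) \<in> finite_rational_subsets A"
proof -
  have "finite_lset (bot(u := q))"
    unfolding finite_lset_def by (rule finite_subset[of _ "{u}"]) auto
  with assms show ?thesis
    by (simp add: finite_rational_subsets_def rational_lset_def le_fun_def)
qed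

lemma Sup_finite_rational_subsets: "Sup (finite_rational_subsets A) = A"
proof (rule antisym)
  show "A \<le> Sup (finite_rational_subsets A)"
  proof (rule le_funI)
    fix u
    have "q \<le> Sup (finite_rational_subsets A) u" if "real_of_unit q \<in> \<rat>" "q \<le> A u" for q
    proof -
      have "bot(u := q) \<le> Sup (finite_rational_subsets A)"
        using that by (intro Sup_upper singleton_mem_finite_rational_subsets)
      from le_funD[OF this, of u] show ?thesis
        by simp
    qed
    then have "Sup {q. real_of_unit q \<in> \<rat> \<and> q \<le> A u} \<le> Sup (finite_rational_subsets A) u"
      by (auto intro: Sup_least)
    then show "A u \<le> Sup (finite_rational_subsets A) u"
      by (simp only: Sup_rationals_le)
  qed
qed (auto simp: finite_rational_subsets_def intro: Sup_least)

definition valid_formulas :: "('v lset \<Rightarrow> 'v lset) \<Rightarrow> 'v fml set" where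
  "valid_formulas C = {(A, B). is_formula (A, B) \<and> B \<le> C A}"

lemma is_theory_valid_formulas: "is_theory (valid_formulas C)"
  by (auto simp: is_theory_def valid_formulas_def)

lemma mem_valid_formulas_if_finite_rational:
  assumes "A \<in> finite_rational_subsets e" "B \<in> finite_rational_subsets (C A)"
  shows "(A, B) \<in> valid_formulas C"
  using assms by (simp add: valid_formulas_def is_formula_def finite_rational_subsets_def)

context residuated_lattice_01
begin

sublocale tensor: comm_monoid tensor top
  by (fact tensor_comm_monoid)

lemma imp_eq_top_iff [simp]: "imp a b = top \<longleftrightarrow> a \<le> b"
  using adjointness[of top a b] by (simp add: top_unique)

lemma tensor_left_mono: "a \<le> b \<Longrightarrow> tensor a c \<le> tensor b c"
  unfolding adjointness by (erule order_trans) (simp flip: adjointness)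

lemma imp_mono:
  assumes "a' \<le> a" "b \<le> b'"
  shows "imp a b \<le> imp a' b'"
proof -
  have "tensor (imp a b) a' \<le> tensor (imp a b) a"
    using tensor_left_mono[OF assms(1), of "imp a b"] by (simp add: tensor.commute)
  also have "\<dots> \<le> b"
    by (simp add: adjointness)
  finally show ?thesis
    using assms(2) by (simp flip: adjointness)
qed

lemma subsethood_eq_top_iff: "subsethood imp A B = top \<longleftrightarrow> A \<le> B"
  by (simp add: subsethood_def le_fun_def INF_top_conv)

lemma subsethood_mono: "A' \<le> A \<Longrightarrow> B \<le> B' \<Longrightarrow> subsethood imp A B \<le> subsethood imp A' B'"
  unfolding subsethood_def by (intro INF_mono' imp_mono) (auto simp: le_fun_def)

lemma scale_lset_le_iff: "scale_lset tensor c A \<le> B \<longleftrightarrow> c \<le> subsethood imp A B"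
  by (simp add: scale_lset_def subsethood_def le_fun_def le_INF_iff adjointness)

lemma subsethood_le_subsethood_closure:
  "L_closure_operator imp C \<Longrightarrow> subsethood imp A B \<le> subsethood imp (C A) (C B)"
  by (simp add: L_closure_operator_def)

lemma L_closure_operator_mono:
  assumes "L_closure_operator imp C" "A \<le> B"
  shows "C A \<le> C B"
  using subsethood_le_subsethood_closure[OF assms(1), of A B] assms(2)
  by (simp add: top_unique flip: subsethood_eq_top_iff)

lemma L_closure_operator_le_SUP:
  assumes "L_closure_operator imp C"
    and "(SUP A\<in>F. subsethood imp D A) = top"
  shows "C D \<le> (SUP A\<in>F. C A)"
proof -
  have "subsethood imp D A \<le> subsethood imp (C D) (SUP A\<in>F. C A)" if "A \<in> F" for A
  proof -
    have "subsethood imp D A \<le> subsethood imp (C D) (C A)"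
      by (rule subsethood_le_subsethood_closure[OF assms(1)])
    also have "\<dots> \<le> subsethood imp (C D) (SUP A\<in>F. C A)"
      using that by (intro subsethood_mono SUP_upper) auto
    finally show ?thesis .
  qed
  then have "(SUP A\<in>F. subsethood imp D A) \<le> subsethood imp (C D) (SUP A\<in>F. C A)"
    by (rule SUP_least)
  with assms(2) show ?thesis
    by (simp only: top_unique subsethood_eq_top_iff)
qed

definition is_model :: "'v fml set \<Rightarrow> 'v lset \<Rightarrow> bool" where
  "is_model \<Sigma> X \<longleftrightarrow> (\<forall>(A, B)\<in>\<Sigma>. subsethood imp A X \<le> subsethood imp B X)"

lemma theory_closure_le_model:
  assumes "is_model \<Sigma> X" "e \<le> X"
  shows "theory_closure tensor imp \<Sigma> e \<le> X"
proof -
  have "iter tensor imp \<Sigma> e n \<le> X" for n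
  proof (induction n)
    case 0
    show ?case using assms(2) by simp
  next
    case (Suc n)
    have "scale_lset tensor (subsethood imp A (iter tensor imp \<Sigma> e n)) B \<le> X"
      if "(A, B) \<in> \<Sigma>" for A B
    proof -
      have "subsethood imp A (iter tensor imp \<Sigma> e n) \<le> subsethood imp A X"
        using Suc.IH by (intro subsethood_mono order_refl)
      also have "\<dots> \<le> subsethood imp B X"
        using assms(1) that by (auto simp: is_model_def)
      finally show ?thesis
        by (simp only: scale_lset_le_iff)
    qed
    with Suc.IH show ?case
      unfolding iter.simps by (intro sup_least SUP_least) auto
  qed
  then show ?thesis
    unfolding theory_closure_def by (rule SUP_least)
qed

lemma subsethood_le_subsethood_theory_closure:
  assumes "(A, B) \<in> \<Sigma>"
  shows "subsethood imp A e \<le> subsethood imp B (theory_closure tensor imp \<Sigma> e)"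
proof -
  have "scale_lset tensor (subsethood imp A e) B \<le> iter tensor imp \<Sigma> e 1"
    using assms by (auto intro!: le_supI2 SUP_upper2[of "(A, B)"])
  also have "\<dots> \<le> theory_closure tensor imp \<Sigma> e"
    unfolding theory_closure_def by (rule SUP_upper) simp
  finally show ?thesis
    by (simp only: scale_lset_le_iff)
qed

lemma consequent_le_theory_closure:
  assumes "(A, B) \<in> \<Sigma>" "A \<le> e"
  shows "B \<le> theory_closure tensor imp \<Sigma> e"
  using subsethood_le_subsethood_theory_closure[OF assms(1), of e] assms(2)
  by (simp add: top_unique flip: subsethood_eq_top_iff)

lemma is_model_valid_formulas_closure:
  assumes "L_closure_operator imp C"
  shows "is_model (valid_formulas C) (C e)"
proof -
  have "subsethood imp A (C e) \<le> subsethood imp B (C e)" if "B \<le> C A" for A B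
  proof -
    have "subsethood imp A (C e) \<le> subsethood imp (C A) (C (C e))"
      by (rule subsethood_le_subsethood_closure[OF assms])
    also have "C (C e) = C e"
      using assms by (simp add: L_closure_operator_def)
    also have "subsethood imp (C A) (C e) \<le> subsethood imp B (C e)"
      using that by (intro subsethood_mono order_refl)
    finally show ?thesis .
  qed
  then show ?thesis
    by (auto simp: is_model_def valid_formulas_def)
qed

end

locale continuous_residuated_lattice_01 = residuated_lattice_01 +
  assumes imp_Sup: "X \<noteq> {} \<Longrightarrow> imp a (Sup X) = (SUP b\<in>X. imp a b)"
begin

lemma SUP_imp_rationals_le: "(SUP q\<in>{q. real_of_unit q \<in> \<rat> \<and> q \<le> a}. imp a q) = top"
    (is "(SUP q\<in>?Q. imp a q) = top")
proof -
  have "bot \<in> ?Q"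
    by simp
  then have "(SUP q\<in>?Q. imp a q) = imp a (Sup ?Q)"
    by (intro imp_Sup[symmetric]) blast
  then show ?thesis
    by (simp add: Sup_rationals_le)
qed

lemma SUP_subsethood_finite_rational_subsets:
  assumes "finite_lset D"
  shows "(SUP A\<in>finite_rational_subsets D. subsethood imp D A) = top"
proof -
  have "c \<le> (SUP A\<in>finite_rational_subsets D. subsethood imp D A)" if "c < top" for c
  proof -
    have "\<exists>q. real_of_unit q \<in> \<rat> \<and> q \<le> D u \<and> c < imp (D u) q" for u
    proof -
      have "c < (SUP q\<in>{q. real_of_unit q \<in> \<rat> \<and> q \<le> D u}. imp (D u) q)"
        using \<open>c < top\<close> by (simp only: SUP_imp_rationals_le)
      then show ?thesis
        unfolding less_SUP_iff by blast
    qed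
    then obtain A where A: "real_of_unit (A u) \<in> \<rat>" "A u \<le> D u" "c < imp (D u) (A u)" for u
      by metis
    then have "A \<le> D" "rational_lset A"
      by (simp_all add: le_fun_def rational_lset_def)
    then have "A \<in> finite_rational_subsets D"
      using finite_lset_subset assms by (auto simp: finite_rational_subsets_def)
    moreover have "c \<le> subsethood imp D A"
      unfolding subsethood_def using A(3) by (intro INF_greatest less_imp_le)
    ultimately show ?thesis
      by (rule SUP_upper2[where f = "subsethood imp D"])
  qed
  then show ?thesis
    by (rule top_le[OF dense_le])
qed

lemma finitary_eq_SUP_finite_rational_subsets:
  assumes "L_closure_operator imp C" "finitary C"
  shows "C e = (SUP A\<in>finite_rational_subsets e. C A)"
proof (rule antisym)
  have "C D \<le> (SUP A\<in>finite_rational_subsets e. C A)" if "D \<le> e" "finite_lset D" for D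
  proof -
    have "C D \<le> (SUP A\<in>finite_rational_subsets D. C A)"
      using assms(1) SUP_subsethood_finite_rational_subsets[OF that(2)]
      by (rule L_closure_operator_le_SUP)
    also have "\<dots> \<le> (SUP A\<in>finite_rational_subsets e. C A)"
      using that(1) by (intro SUP_subset_mono) (auto simp: finite_rational_subsets_def)
    finally show ?thesis .
  qed
  moreover have "C e = Sup {C D | D. D \<le> e \<and> finite_lset D}"
    using assms(2) unfolding finitary_def by blast
  ultimately show "C e \<le> (SUP A\<in>finite_rational_subsets e. C A)"
    by (auto intro: Sup_least)
  show "(SUP A\<in>finite_rational_subsets e. C A) \<le> C e"
    using L_closure_operator_mono[OF assms(1)] by (auto simp: finite_rational_subsets_def intro: SUP_least)
qed

end

theorem theorem4:
  fixes tensor imp :: "unit_interval \<Rightarrow> unit_interval \<Rightarrow> unit_interval"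
    and C :: "('v :: {countable, infinite}) lset \<Rightarrow> 'v lset"
  assumes "residuated_lattice_01 tensor imp"
    and "\<And>a X. X \<noteq> {} \<Longrightarrow> imp a (Sup X) = (SUP b\<in>X. imp a b)"
    and "L_closure_operator imp C"
    and "finitary C"
  shows "\<exists>\<Sigma> :: 'v fml set. is_theory \<Sigma> \<and> C = theory_closure tensor imp \<Sigma>"
proof -
  interpret continuous_residuated_lattice_01 tensor imp
    using assms(1,2)
    by (intro continuous_residuated_lattice_01.intro continuous_residuated_lattice_01_axioms.intro)
  have "C e = theory_closure tensor imp (valid_formulas C) e" for e
  proof (rule antisym)
    have "C e = (SUP A\<in>finite_rational_subsets e. Sup (finite_rational_subsets (C A)))"
      unfolding Sup_finite_rational_subsets
      by (rule finitary_eq_SUP_finite_rational_subsets[OF assms(3,4)])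
    also have "\<dots> \<le> theory_closure tensor imp (valid_formulas C) e"
      by (intro SUP_least Sup_least)
        (rule consequent_le_theory_closure[OF mem_valid_formulas_if_finite_rational],
          auto simp: finite_rational_subsets_def)
    finally show "C e \<le> theory_closure tensor imp (valid_formulas C) e" .
    show "theory_closure tensor imp (valid_formulas C) e \<le> C e"
      using assms(3) by (intro theory_closure_le_model is_model_valid_formulas_closure)
        (simp_all add: L_closure_operator_def)
  qed
  then show ?thesis
    using is_theory_valid_formulas by blast
qed

end
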